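(* For the one-sided shift there is a unique renormalization operator, up to a constant parameter $a\in\mathbb N$, $a\ge1$. Precisely: let $H:\Sigma\to\Sigma$ be an increasing function for the lexicographic order such that (1) for every $x=(1,x_2,x_3,\ldots)$, $H(x)=(\underbrace{0,\ldots,0}_{a\ \text{terms}},1,x_2,x_3,\ldots)$, where $a\ge1$; (2) $H^{-1}\circ\sigma^2\circ H=\sigma$; (3) $H(0^\infty)=0^\infty$. Then for every $x=(\underbrace{0,\ldots,0}_{n_0\ \text{terms}},1,x_{n_0+2},\ldots)$ one has $$H(x)=(\underbrace{0,\ldots,0}_{2n_0+a\ \text{terms}},1,x_{n_0+2},\ldots).$$ Consequently each renormalization operator has to be of the following form: for a fixed $a\in\mathbb N$, given $V:\{0,1\}^{\mathbb N}\to\mathbb R$ and any $x=(\underbrace{0,\ldots,0}_{c_1},\underbrace{1,\ldots,1}_{c_2},\underbrace{0,\ldots,0}_{c_3},1,\ldots)$, $$\mathcal R(V)(x)=V\big((\underbrace{0,\ldots,0}_{2c_1+a-1},\underbrace{1,\ldots,1}_{c_2},\underbrace{0,\ldots,0}_{c_3},1,\ldots)\big)+V\big((\underbrace{0,\ldots,0}_{2c_1+a},\underbrace{1,\ldots,1}_{c_2},\underbrace{0,\ldots,0}_{c_3},1,\ldots)\big).$$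
   Context: $\Sigma=\{0,1\}^{\mathbb N}$ is the one-sided full shift space on two symbols, with elements written $x=(x_1,x_2,x_3,\ldots)$ and ordered by the lexicographic order with $0<1$. $\sigma:\Sigma\to\Sigma$ is the shift $\sigma(x_1,x_2,x_3,\ldots)=(x_2,x_3,\ldots)$, and $0^\infty=(0,0,0,\ldots)$. A renormalization operator on the shift is an operator acting on potentials $V:\Sigma\to\mathbb R$ by $\mathcal R(V)(x)=V(\sigma(H(x)))+V(H(x))$, where $H:\Sigma\to\Sigma$ is an increasing map satisfying conditions (1)-(3) of the claim.
   Formalization: Condition (2) is required only at points x beginning with 0: imposed at points beginning with 1 too, it contradicts (1), since it would force H(y)=σ²(0^a 1 y) for all y, which fails for y=(1,z), so no H would exist. *)

theory Defs
  imports Complex_Main "HOL-Library.Stream" "HOL-Library.Fun_Lexorder"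
begin

text \<open>
  The full one-sided shift is the type \<^typ>\<open>bool stream\<close>, with \<^term>\<open>False\<close> for the symbol 0 and
  \<^term>\<open>True\<close> for the symbol 1, so that the order on \<^typ>\<open>bool\<close> is 0 < 1; the shift map is
  \<^const>\<open>stl\<close>.
\<close>

abbreviation zeros :: "nat \<Rightarrow> bool list" where
  "zeros n \<equiv> replicate n False"

abbreviation ones :: "nat \<Rightarrow> bool list" where
  "ones n \<equiv> replicate n True"

definition lex_le :: "bool stream \<Rightarrow> bool stream \<Rightarrow> bool" where
  "lex_le x y \<longleftrightarrow> x = y \<or> less_fun (snth x) (snth y)"

text \<open>
  The last conjunct is the condition that (inverse of \<open>H\<close>) \<open>\<circ>\<close> \<open>\<sigma>\<^sup>2\<close> \<open>\<circ>\<close> \<open>H\<close> equals \<open>\<sigma>\<close>. Since \<open>H\<close> is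
  not surjective its inverse is a partial map: the condition at \<open>x\<close> says that \<open>\<sigma>\<^sup>2 (H x)\<close> has exactly
  one preimage under \<open>H\<close>, namely \<open>\<sigma> x\<close>. In particular \<open>H\<close> is injective, so it makes no difference
  whether ``increasing'' is read strictly or not.

  It is imposed at the points \<open>x\<close> whose first symbol is 0. Imposed at the points
  beginning with 1 as well, it would contradict the condition on \<open>H (1, x\<^sub>2, x\<^sub>3, \<dots>)\<close>, and no map
  would qualify; see \<open>conjugacy_fails_on_ones\<close> below.
\<close>

definition renormalization_map :: "nat \<Rightarrow> (bool stream \<Rightarrow> bool stream) \<Rightarrow> bool" where
  "renormalization_map a H \<longleftrightarrow>
     a \<ge> 1 \<and>
     monotone lex_le lex_le H \<and>
     (\<forall>y. H (True ## y) = zeros a @- True ## y) \<and>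
     H (sconst False) = sconst False \<and>
     (\<forall>x. shd x = False \<longrightarrow> H -` {stl (stl (H x))} = {stl x})"

lemma conjugacy_fails_on_ones:
  assumes a: "a \<ge> 1" and H: "\<And>y. H (True ## y) = zeros a @- True ## y"
  shows "\<exists>x. shd x = True \<and> H -` {stl (stl (H x))} \<noteq> {stl x}"
proof (rule ccontr)
  assume "\<not> ?thesis"
  then have *: "H -` {stl (stl (H (True ## y)))} = {y}" for y
    by (metis stream.sel)
  have eq: "H y = stl (stl (H (True ## y)))" for y
    using *[of y] by auto
  obtain b where b: "a = Suc b" using a by (cases a) auto
  show False
  proof (cases b)
    case 0
    show False using eq[of "True ## y" for y] by (simp add: H b 0)
  next
    case (Suc c)
    have "zeros (Suc (Suc c)) @- True ## y = zeros c @- True ## True ## y" for y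
      using eq[of "True ## y"] by (simp add: H b Suc)
    then have "(zeros (Suc (Suc c)) @- True ## y) !! c = (zeros c @- True ## True ## y) !! c" for y
      by metis
    then show False by (simp add: shift_snth del: replicate.simps)
  qed
qed

definition renormalize ::
    "(bool stream \<Rightarrow> bool stream) \<Rightarrow> (bool stream \<Rightarrow> real) \<Rightarrow> (bool stream \<Rightarrow> real)" where
  "renormalize H V = (\<lambda>x. V (stl (H x)) + V (H x))"

definition renormalization_operator ::
    "nat \<Rightarrow> ((bool stream \<Rightarrow> real) \<Rightarrow> (bool stream \<Rightarrow> real)) \<Rightarrow> bool" where
  "renormalization_operator a R \<longleftrightarrow> (\<exists>H. renormalization_map a H \<and> R = renormalize H)"

end

theory Submission
  imports Defs
begin

text \<open>
  Every point of the shift other than \<open>0\<^sup>\<infinity>\<close> is \<open>0\<^sup>n1y\<close> for exactly one \<open>n\<close> and \<open>y\<close>, so \<open>H\<close> can be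
  computed by induction on \<open>n\<close>. The conjugacy condition says that \<open>H(0x) = b\<^sub>1b\<^sub>2H(x)\<close> for two unknown
  symbols. Since \<open>0x\<close> lies below \<open>10\<^sup>\<infinity>\<close>, monotonicity gives \<open>b\<^sub>1b\<^sub>2H(x) \<le> H(10\<^sup>\<infinity>) = 0\<^sup>a10\<^sup>\<infinity>\<close>, and this
  forces both symbols to be 0: for \<open>a \<ge> 2\<close> at once, and for \<open>a = 1\<close> because \<open>01H(x) \<le> 010\<^sup>\<infinity>\<close> would
  make \<open>H(x)\<close> equal to \<open>0\<^sup>\<infinity>\<close>, which is excluded by the symbol 1 in \<open>H(x)\<close>. So each
  further leading 0 of the argument puts two more in front of the value
  (\<open>renormalization_map_first_one\<close>), and, as \<open>H(0\<^sup>\<infinity>)\<close> is prescribed, \<open>H\<close> is determined by \<open>a\<close>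
  (\<open>renormalization_map_unique\<close>).

  Conversely, the map given by \<open>0\<^sup>n1y \<mapsto> 0\<^sup>2\<^sup>n\<^sup>+\<^sup>a1y\<close> does satisfy the conditions
  (\<open>renormalization_map_canonical\<close>). Monotonicity holds because the order of two nonzero points is
  decided by their numbers of leading zeros, and by their tails when these agree; \<open>n \<mapsto> 2n + a\<close> is
  strictly increasing and leaves the tails alone.
\<close>

section \<open>Streams by the position of their first 1\<close>

lemma sconst_False_or_first_one:
  obtains "x = sconst False" | n y where "x = zeros n @- True ## y"
proof (cases "\<exists>n. x !! n")
  case True
  define n where "n = (LEAST n. x !! n)"
  have one: "x !! n"
    unfolding n_def using True by (rule LeastI_ex)
  have "\<not> x !! k" if "k < n" for k
    using that not_less_Least unfolding n_def by blast
  then have "stake n x = zeros n"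
    by (intro nth_equalityI) auto
  then have "x = zeros n @- True ## sdrop (Suc n) x"
    using id_stake_snth_sdrop[of x n] one by (simp only: eq_True)
  then show thesis by (rule that(2))
next
  case False
  then have "sset x = {False}"
    by (auto simp: sset_range)
  then have "x = sconst False"
    by (simp add: sconst_alt)
  then show thesis by (rule that(1))
qed

lemma sconst_False_Cons: "sconst False = False ## sconst False"
  by (subst siterate.code) simp

lemma zeros_shift_True_inject [simp]:
  "zeros n @- True ## x = zeros m @- True ## y \<longleftrightarrow> n = m \<and> x = y"
proof (induction n arbitrary: m)
  case 0
  then show ?case by (cases m) auto
next
  case (Suc n)
  then show ?case by (cases m) auto
qed

lemma zeros_shift_True_neq_sconst [simp]: "zeros n @- True ## x \<noteq> sconst False"
proof
  assume "zeros n @- True ## x = sconst False"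
  then have "sset (zeros n @- True ## x) = {False}"
    by (simp only: sset_sconst)
  then show False by auto
qed

lemmas sconst_neq_zeros_shift_True [simp] = zeros_shift_True_neq_sconst [symmetric]

section \<open>The lexicographic order\<close>

lemma lex_le_refl [simp]: "lex_le x x"
  by (simp add: lex_le_def)

lemma lex_le_Cons [simp]: "lex_le (b ## x) (c ## y) \<longleftrightarrow> b < c \<or> b = c \<and> lex_le x y"
proof -
  have split: "(\<exists>k. P k) \<longleftrightarrow> P 0 \<or> (\<exists>k. P (Suc k))" for P :: "nat \<Rightarrow> bool"
    by (metis not0_implies_Suc)
  have "less_fun (snth (b ## x)) (snth (c ## y)) \<longleftrightarrow> b < c \<or> b = c \<and> less_fun (snth x) (snth y)"
    unfolding less_fun_def by (subst split) (auto simp: All_less_Suc2)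
  then show ?thesis
    by (auto simp: lex_le_def)
qed

lemma lex_le_zeros_shift: "lex_le (zeros n @- x) (zeros n @- y) \<longleftrightarrow> lex_le x y"
  by (induction n) simp_all

text \<open>
  Points are compared with \<open>0\<^sup>\<infinity>\<close> by writing it as \<open>0\<^sup>n00\<^sup>\<infinity>\<close> and cancelling the common prefix.
\<close>

lemma lex_le_sconst_False [simp]: "lex_le (sconst False) x"
proof (cases x rule: sconst_False_or_first_one)
  case 1
  show ?thesis unfolding 1 by (rule lex_le_refl)
next
  case (2 n y)
  have "lex_le (zeros n @- False ## sconst False) (zeros n @- True ## y)"
    unfolding lex_le_zeros_shift by simp
  then show ?thesis
    unfolding 2 sconst_False_Cons [symmetric] shift_replicate_sconst .
qed

lemma not_lex_le_sconst_False [simp]: "\<not> lex_le (zeros n @- True ## x) (sconst False)"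
proof -
  have "\<not> lex_le (zeros n @- True ## x) (zeros n @- False ## sconst False)"
    unfolding lex_le_zeros_shift by simp
  then show ?thesis
    unfolding sconst_False_Cons [symmetric] shift_replicate_sconst .
qed

lemma lex_le_first_one [simp]:
  "lex_le (zeros n @- True ## x) (zeros m @- True ## y) \<longleftrightarrow> m < n \<or> m = n \<and> lex_le x y"
proof (induction n arbitrary: m)
  case 0
  then show ?case by (cases m) auto
next
  case (Suc n)
  then show ?case by (cases m) auto
qed

section \<open>Renormalization maps are determined by their parameter\<close>

text \<open>
  The conjugacy condition leaves only the first two symbols of \<open>H(0x)\<close> open. A symbol 1 among them
  would push \<open>H(0x)\<close> above \<open>H(10\<^sup>\<infinity>)\<close>, against monotonicity; this needs \<open>H(x) \<noteq> 0\<^sup>\<infinity>\<close> when \<open>a = 1\<close>.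
\<close>

lemma renormalization_map_False:
  assumes H: "renormalization_map a H" and first_one: "H x = zeros m @- True ## y"
  shows "H (False ## x) = False ## False ## H x"
proof -
  have "\<forall>z. shd z = False \<longrightarrow> H -` {stl (stl (H z))} = {stl z}"
    using H unfolding renormalization_map_def by (elim conjE)
  from spec[OF this, of "False ## x"] have "x \<in> H -` {stl (stl (H (False ## x)))}"
    by simp
  then have tail: "stl (stl (H (False ## x))) = H x"
    by simp
  obtain b c where bc: "H (False ## x) = b ## c ## H x"
    using tail by (metis stream.collapse)
  have "monotone lex_le lex_le H"
    using H unfolding renormalization_map_def by (elim conjE)
  then have "lex_le (H (False ## x)) (H (True ## sconst False))"
    by (rule monotoneD) simp
  moreover have "H (True ## sconst False) = zeros a @- True ## sconst False"
    using H unfolding renormalization_map_def by blast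
  ultimately have le: "lex_le (b ## c ## zeros m @- True ## y) (zeros a @- True ## sconst False)"
    by (simp add: bc first_one)
  have "a \<ge> 1"
    using H by (simp add: renormalization_map_def)
  then obtain k where a: "a = Suc k"
    by (cases a) auto
  \<comment> \<open>The case \<open>k = 0\<close> is the one in which the comparison reaches the tail \<open>H x \<le> 0\<^sup>\<infinity>\<close>.\<close>
  have "\<not> b \<and> \<not> c"
    using le by (cases k) (auto simp: a)
  then show ?thesis
    using bc by simp
qed

theorem renormalization_map_first_one:
  assumes "renormalization_map a H"
  shows "H (zeros n @- True ## y) = zeros (2 * n + a) @- True ## y"
proof (induction n)
  case 0
  then show ?case
    using assms by (simp add: renormalization_map_def)
next
  case (Suc n)
  show ?case
    using renormalization_map_False[OF assms Suc] Suc by simp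
qed

lemma renormalization_map_unique:
  assumes H: "renormalization_map a H" and G: "renormalization_map a G"
  shows "H = G"
proof
  fix x
  show "H x = G x"
  proof (cases x rule: sconst_False_or_first_one)
    case 1
    then show ?thesis
      using H G by (simp add: renormalization_map_def)
  next
    case 2
    then show ?thesis
      using renormalization_map_first_one[OF H] renormalization_map_first_one[OF G] by simp
  qed
qed

section \<open>The canonical renormalization map\<close>

text \<open>
  The number of leading zeros is found by a description over all decompositions
  \<open>x = 0\<^sup>n1y\<close>, of which there is exactly one when \<open>x\<close> is not \<open>0\<^sup>\<infinity>\<close>. Only the additional \<open>n + a\<close> zeros
  are put in front, the other \<open>n\<close> being those of \<open>x\<close> itself.
\<close>

definition canonical_map :: "nat \<Rightarrow> bool stream \<Rightarrow> bool stream" where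
  "canonical_map a x =
     (if x = sconst False then x else zeros ((THE n. \<exists>y. x = zeros n @- True ## y) + a) @- x)"

lemma canonical_map_sconst [simp]: "canonical_map a (sconst False) = sconst False"
  by (simp add: canonical_map_def)

lemma canonical_map_first_one [simp]:
  "canonical_map a (zeros n @- True ## y) = zeros (2 * n + a) @- True ## y"
proof -
  have "zeros (n + a) @- zeros n @- True ## y = zeros (2 * n + a) @- True ## y"
    by (metis add.assoc add.commute mult_2 replicate_add shift_append)
  then show ?thesis
    by (simp add: canonical_map_def)
qed

lemma canonical_map_False: "canonical_map a (False ## x) = False ## False ## canonical_map a x"
proof (cases x rule: sconst_False_or_first_one)
  case 1
  then show ?thesis
    by (metis canonical_map_sconst sconst_False_Cons)
next
  case (2 n y)
  then show ?thesis
    using canonical_map_first_one[of a "Suc n" y] by simp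
qed

lemma inj_canonical_map: "inj (canonical_map a)"
proof (rule injI)
  fix x y
  assume eq: "canonical_map a x = canonical_map a y"
  show "x = y"
    using eq
    by (cases x rule: sconst_False_or_first_one; cases y rule: sconst_False_or_first_one; simp)
qed

lemma monotone_canonical_map: "monotone lex_le lex_le (canonical_map a)"
proof (rule monotoneI)
  fix x y
  assume le: "lex_le x y"
  show "lex_le (canonical_map a x) (canonical_map a y)"
    using le
    by (cases x rule: sconst_False_or_first_one; cases y rule: sconst_False_or_first_one; force)
qed

lemma renormalization_map_canonical:
  assumes "a \<ge> 1"
  shows "renormalization_map a (canonical_map a)"
proof -
  have "canonical_map a -` {stl (stl (canonical_map a x))} = {stl x}" if "shd x = False" for x
  proof -
    have "stl (stl (canonical_map a x)) = canonical_map a (stl x)"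
      using canonical_map_False[of a "stl x"] that by (metis stream.collapse stream.sel(2))
    then show ?thesis
      using inj_canonical_map[of a] by (auto dest: injD)
  qed
  moreover have "canonical_map a (True ## y) = zeros a @- True ## y" for y
    using canonical_map_first_one[of a 0 y] by simp
  ultimately show ?thesis
    using assms monotone_canonical_map by (simp add: renormalization_map_def)
qed

section \<open>The renormalization operator\<close>

theorem theoremA:
  shows "(\<forall>a\<ge>1. \<exists>!R. renormalization_operator a R) \<and>
    (\<forall>a H. renormalization_map a H \<longrightarrow>
      (\<forall>n y. H (zeros n @- True ## y) = zeros (2 * n + a) @- True ## y)) \<and>
    (\<forall>a R. renormalization_operator a R \<longrightarrow>
      (\<forall>V c1 c2 c3 y. c2 \<ge> 1 \<longrightarrow>
        R V (zeros c1 @- ones c2 @- zeros c3 @- True ## y) =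
          V (zeros (2 * c1 + a - 1) @- ones c2 @- zeros c3 @- True ## y) +
          V (zeros (2 * c1 + a) @- ones c2 @- zeros c3 @- True ## y)))"
proof (intro conjI allI impI)
  fix a :: nat
  assume "a \<ge> 1"
  then show "\<exists>!R. renormalization_operator a R"
    unfolding renormalization_operator_def
    by (metis renormalization_map_canonical renormalization_map_unique)
next
  fix a H n y
  assume "renormalization_map a H"
  then show "H (zeros n @- True ## y) = zeros (2 * n + a) @- True ## y"
    by (rule renormalization_map_first_one)
next
  fix a R V c1 c2 c3 y
  assume "renormalization_operator a R" and c2: "(c2::nat) \<ge> 1"
  then obtain H where H: "renormalization_map a H" and R: "R = renormalize H"
    unfolding renormalization_operator_def by blast
  define x where "x = ones c2 @- zeros c3 @- True ## y"
  have x: "x = True ## stl x"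
    using c2 by (cases c2) (simp_all add: x_def)
  have Hx: "H (zeros c1 @- x) = zeros (2 * c1 + a) @- x"
    using renormalization_map_first_one[OF H, of c1 "stl x"] x by metis
  have "a \<ge> 1"
    using H by (simp add: renormalization_map_def)
  then obtain k where "2 * c1 + a = Suc k"
    by (cases a) auto
  then have "stl (zeros (2 * c1 + a) @- x) = zeros (2 * c1 + a - 1) @- x"
    by simp
  then have "R V (zeros c1 @- x) = V (zeros (2 * c1 + a - 1) @- x) + V (zeros (2 * c1 + a) @- x)"
    by (simp add: R renormalize_def Hx)
  then show "R V (zeros c1 @- ones c2 @- zeros c3 @- True ## y) =
      V (zeros (2 * c1 + a - 1) @- ones c2 @- zeros c3 @- True ## y) +
      V (zeros (2 * c1 + a) @- ones c2 @- zeros c3 @- True ## y)"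
    by (simp add: x_def)
qed

end
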